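(* Let $G=(V,E)$ be a graph, let $C\subseteq V$ induce an odd cycle in $G$, and let $k\in C$. Then every $X_C=(X_{ij})_{i,j\in C}\in\mathrm{STAB}^2(G_C)$ satisfies $$\sum_{\substack{i\in C\\ i\notin N[k]}}X_{ik}\le\tfrac12(|C|-3)X_{kk}$$ and $$\sum_{i\in C}X_{ii}+\tfrac12(|C|-3)X_{kk}\le\tfrac12(|C|-1)+\sum_{\substack{i\in C\\ i\notin N[k]}}X_{ik}.$$
   Context: Graphs are finite, simple and undirected. For $I\subseteq V$, $G_I$ is the subgraph of $G$ induced by $I$. $N[k]$ is the closed neighborhood of $k$ in $G$, i.e. $k$ together with all vertices adjacent to $k$. A cycle is a sequence of distinct vertices $i_1,\dots,i_r$ ($r\ge3$) such that consecutive vertices are adjacent and $i_r$ is adjacent to $i_1$; it may have chords (further edges between its vertices). An odd cycle is a cycle with an odd number of vertices. A set $C$ induces an odd cycle in $G$ if $C$ is the vertex set of an odd cycle in $G$. For a graph $H$, $\mathcal{S}(H)\subseteq\{0,1\}^{V(H)}$ is the set of incidence vectors of stable sets of $H$ (including the empty set), $\mathcal{S}^2(H)=\{ss^\top : s\in\mathcal{S}(H)\}$, and $\mathrm{STAB}^2(H)=\mathrm{conv}\,\mathcal{S}^2(H)$. *)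

theory Defs
  imports "HOL-Analysis.Analysis" "Graph_Theory.Digraph_Component"
begin

(* Finite simple undirected graphs are the library's Digraph.graph: finite, loop-free,
   symmetric digraphs without parallel arcs.  Adjacency is the relation dominates, and the
   subgraph induced by a set I of vertices is induce_subgraph G I. *)

(* The library's cycles of a symmetric digraph include a,b,a, hence a separate notion.
   Chords are allowed. *)
definition is_cycle :: "('v, 'e) pre_digraph \<Rightarrow> 'v list \<Rightarrow> bool" where
  "is_cycle G vs \<longleftrightarrow>
     length vs \<ge> 3 \<and> distinct vs \<and> set vs \<subseteq> verts G \<and>
     (\<forall>j. Suc j < length vs \<longrightarrow> vs ! j \<rightarrow>\<^bsub>G\<^esub> vs ! Suc j) \<and>
     last vs \<rightarrow>\<^bsub>G\<^esub> hd vs"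

definition induces_odd_cycle :: "('v, 'e) pre_digraph \<Rightarrow> 'v set \<Rightarrow> bool" where
  "induces_odd_cycle G C \<longleftrightarrow> (\<exists>vs. is_cycle G vs \<and> odd (length vs) \<and> set vs = C)"

definition closed_neighborhood :: "('v, 'e) pre_digraph \<Rightarrow> 'v \<Rightarrow> 'v set" where
  "closed_neighborhood G k = insert k {v. k \<rightarrow>\<^bsub>G\<^esub> v}"

definition stable_set :: "('v, 'e) pre_digraph \<Rightarrow> 'v set \<Rightarrow> bool" where
  "stable_set H S \<longleftrightarrow> S \<subseteq> verts H \<and> (\<forall>u\<in>S. \<forall>v\<in>S. \<not> u \<rightarrow>\<^bsub>H\<^esub> v)"

definition incidence_vector :: "'v set \<Rightarrow> real ^ ('v::finite)" where
  "incidence_vector S = (\<chi> i. indicator S i)"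

(* For a graph H whose vertices form a proper subset of the type 'v, the spaces of vectors
   indexed by verts H and of matrices indexed by verts H \<times> verts H are identified with the
   subspaces of real ^ 'v and real ^ 'v ^ 'v whose entries vanish at all other indices. *)

definition stable_vectors :: "('v::finite, 'e) pre_digraph \<Rightarrow> (real ^ 'v) set" where
  "stable_vectors H = {incidence_vector S | S. stable_set H S}"

definition outer_square :: "real ^ ('v::finite) \<Rightarrow> real ^ 'v ^ 'v" where
  "outer_square s = (\<chi> i j. s $ i * s $ j)"

definition STAB2 :: "('v::finite, 'e) pre_digraph \<Rightarrow> (real ^ 'v ^ 'v) set" where
  "STAB2 H = convex hull (outer_square ` stable_vectors H)"

end

theory Submission
  imports Defs
begin

text \<open>
  Both inequalities are affine in \<open>X\<close>, so it is enough to verify them at the generators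
  \<open>s s\<^sup>T\<close> of the convex hull, where \<open>s\<close> is the incidence vector of a set
  \<open>S \<subseteq> C\<close> that is stable in the subgraph induced by \<open>C\<close>.  There the entry at
  \<open>(i, k)\<close> is 1 if \<open>i\<close> and \<open>k\<close> both lie in \<open>S\<close>, and 0 otherwise.

  If \<open>k \<notin> S\<close>, the first inequality reads \<open>0 \<le> 0\<close> and the second
  \<open>2 |S| \<le> |C| - 1\<close>.  If \<open>k \<in> S\<close>, stability gives \<open>S \<inter> N[k] = {k}\<close>, so the sum over
  the non-neighbours of \<open>k\<close> is \<open>|S| - 1\<close>: the first inequality is again
  \<open>2 |S| \<le> |C| - 1\<close>, and the second is an equality.

  What remains is the bound \<open>2 |S| \<le> |C| - 1\<close> on stable sets of an odd cycle
  (\<open>odd_cycle_stable_card\<close>).  The successor map along the cycle is injective and sends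
  \<open>S\<close> to a set disjoint from \<open>S\<close>, hence \<open>2 |S| \<le> |C|\<close>, and equality is excluded by parity.
  Chords of the cycle only make fewer sets stable.
\<close>

text \<open>Reducing the index modulo the length treats the closing edge like all the others.\<close>

lemma is_cycle_dominates_succ:
  assumes "is_cycle G vs" "j < length vs"
  shows "vs ! j \<rightarrow>\<^bsub>G\<^esub> vs ! (Suc j mod length vs)"
proof (cases "Suc j < length vs")
  case True
  then show ?thesis
    using assms(1) by (simp add: is_cycle_def)
next
  case False
  with assms(2) have j: "Suc j = length vs" by simp
  then have "vs \<noteq> []" and "j = length vs - 1" by auto
  then have "vs ! j = last vs" and "vs ! (Suc j mod length vs) = hd vs"
    using j by (simp_all add: last_conv_nth hd_conv_nth)
  then show ?thesis
    using assms(1) by (simp add: is_cycle_def)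
qed

text \<open>
  The positions of \<open>S\<close> on the cycle and the positions that follow them are disjoint sets of the
  same size.  Counting positions rather than vertices makes the successor map explicit.
\<close>

lemma cycle_stable_card:
  assumes cyc: "is_cycle G vs" and "S \<subseteq> set vs"
    and stable: "\<And>u v. u \<in> S \<Longrightarrow> v \<in> S \<Longrightarrow> \<not> u \<rightarrow>\<^bsub>G\<^esub> v"
  shows "2 * card S \<le> length vs"
proof -
  let ?n = "length vs"
  define I where "I = {j. j < ?n \<and> vs ! j \<in> S}"
  let ?next = "\<lambda>j. Suc j mod ?n"
  have "distinct vs" and n: "?n > 0"
    using cyc by (auto simp: is_cycle_def)
  have "bij_betw ((!) vs) I S"
  proof (rule bij_betw_imageI)
    show "inj_on ((!) vs) I"
      using \<open>distinct vs\<close> by (auto simp: I_def inj_on_def nth_eq_iff_index_eq)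
    show "(!) vs ` I = S"
      using \<open>S \<subseteq> set vs\<close> by (fastforce simp: I_def in_set_conv_nth)
  qed
  then have card_I: "card I = card S"
    by (rule bij_betw_same_card)
  have "inj_on ?next I"
    by (auto simp: I_def inj_on_def mod_Suc split: if_splits)
  then have card_next: "card (?next ` I) = card I"
    by (rule card_image)
  have "finite I" and "I \<union> ?next ` I \<subseteq> {..<?n}"
    using n by (auto simp: I_def)
  moreover have "I \<inter> ?next ` I = {}"
    using is_cycle_dominates_succ[OF cyc] stable by (fastforce simp: I_def)
  ultimately have "card I + card (?next ` I) \<le> card {..<?n}"
    by (metis card_Un_disjoint card_mono finite_imageI finite_lessThan)
  with card_I card_next show ?thesis by simp
qed

lemma odd_cycle_stable_card:
  assumes "induces_odd_cycle G C" "S \<subseteq> C"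
    and "\<And>u v. u \<in> S \<Longrightarrow> v \<in> S \<Longrightarrow> \<not> u \<rightarrow>\<^bsub>G\<^esub> v"
  shows "2 * card S + 1 \<le> card C"
proof -
  obtain vs where vs: "is_cycle G vs" "odd (length vs)" "set vs = C"
    using assms(1) by (auto simp: induces_odd_cycle_def)
  have "card C = length vs"
    using vs by (auto simp: is_cycle_def distinct_card)
  moreover have "2 * card S \<le> length vs"
    using cycle_stable_card[OF vs(1)] assms(2,3) vs(3) by blast
  moreover have "2 * card S \<noteq> length vs"
    using vs(2) by (metis dvd_triv_left)
  ultimately show ?thesis by simp
qed

lemma stable_set_induce_subgraph:
  assumes "stable_set (G \<restriction> C) S"
  shows "S \<subseteq> C" and "u \<in> S \<Longrightarrow> v \<in> S \<Longrightarrow> \<not> u \<rightarrow>\<^bsub>G\<^esub> v"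
  using assms
  by (fastforce simp: stable_set_def induce_subgraph_def arcs_ends_def arc_to_ends_def)+

lemma linear_le_on_convex_hull:
  fixes f :: "'a::real_vector \<Rightarrow> real"
  assumes "linear f" "\<And>x. x \<in> A \<Longrightarrow> f x \<le> c" "y \<in> convex hull A"
  shows "f y \<le> c"
proof -
  have "convex (f -` {..c})"
    using assms(1) by (intro convex_linear_vimage) auto
  then have "convex hull A \<subseteq> f -` {..c}"
    using assms(2) by (intro hull_minimal) auto
  with assms(3) show ?thesis by auto
qed

lemma linear_le_on_STAB2:
  fixes f :: "real ^ 'v ^ ('v::finite) \<Rightarrow> real"
  assumes "linear f" "X \<in> STAB2 H"
    and "\<And>S. stable_set H S \<Longrightarrow> f (outer_square (incidence_vector S)) \<le> c"
  shows "f X \<le> c"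
proof (rule linear_le_on_convex_hull[OF assms(1)])
  show "X \<in> convex hull (outer_square ` stable_vectors H)"
    using assms(2) by (simp add: STAB2_def)
qed (use assms(3) in \<open>auto simp: stable_vectors_def\<close>)

lemma outer_square_incidence_vector_nth:
  "outer_square (incidence_vector S) $ i $ j = of_bool (i \<in> S \<and> j \<in> S)"
  by (simp add: outer_square_def incidence_vector_def indicator_def)

lemma sum_outer_square_diagonal:
  fixes C :: "('v::finite) set"
  assumes "S \<subseteq> C"
  shows "(\<Sum>i\<in>C. outer_square (incidence_vector S) $ i $ i) = real (card S)"
  using assms
  by (simp add: outer_square_incidence_vector_nth of_bool_def sum.If_cases Int_absorb1)

text \<open>
  For \<open>k \<in> S\<close>, stability makes \<open>k\<close> the only element of \<open>S\<close> inside its closed neighbourhood,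
  so leaving out that neighbourhood drops exactly one nonzero term.
\<close>

lemma sum_outer_square_non_neighbors:
  fixes C :: "('v::finite) set"
  assumes "S \<subseteq> C" and stable: "\<And>u v. u \<in> S \<Longrightarrow> v \<in> S \<Longrightarrow> \<not> u \<rightarrow>\<^bsub>G\<^esub> v"
  shows "(\<Sum>i\<in>{i \<in> C. i \<notin> closed_neighborhood G k}. outer_square (incidence_vector S) $ i $ k)
    = (if k \<in> S then real (card S) - 1 else 0)"
proof (cases "k \<in> S")
  case True
  then have "{i \<in> C. i \<notin> closed_neighborhood G k} \<inter> S = S - {k}"
    using assms by (auto simp: closed_neighborhood_def)
  moreover have "card S \<ge> 1"
    using True by (metis One_nat_def Suc_leI card_gt_0_iff empty_iff finite)
  ultimately show ?thesis
    using True
    by (simp add: outer_square_incidence_vector_nth of_bool_def sum.If_cases of_nat_diff)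
qed (simp add: outer_square_incidence_vector_nth)

theorem lemma16:
  fixes G :: "('v::finite, 'e) pre_digraph" and C :: "'v set" and k :: 'v
    and X :: "real ^ 'v ^ 'v"
  assumes "Digraph.graph G"
    and "C \<subseteq> verts G"
    and "induces_odd_cycle G C"
    and "k \<in> C"
    and "X \<in> STAB2 (G \<restriction> C)"
  shows "((\<Sum>i\<in>{i \<in> C. i \<notin> closed_neighborhood G k}. X $ i $ k)
           \<le> 1 / 2 * (real (card C) - 3) * X $ k $ k)
    \<and> ((\<Sum>i\<in>C. X $ i $ i) + 1 / 2 * (real (card C) - 3) * X $ k $ k
           \<le> 1 / 2 * (real (card C) - 1)
             + (\<Sum>i\<in>{i \<in> C. i \<notin> closed_neighborhood G k}. X $ i $ k))"
proof -
  let ?D = "{i \<in> C. i \<notin> closed_neighborhood G k}"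
  let ?a = "1 / 2 * (real (card C) - 3)"
  define f where "f Y = (\<Sum>i\<in>?D. Y $ i $ k) - ?a * Y $ k $ k" for Y :: "real ^ 'v ^ 'v"
  define g where "g Y = (\<Sum>i\<in>C. Y $ i $ i) + ?a * Y $ k $ k - (\<Sum>i\<in>?D. Y $ i $ k)"
    for Y :: "real ^ 'v ^ 'v"
  have linear: "linear f" "linear g"
    unfolding f_def g_def
    by (intro linearI; simp add: sum.distrib sum_distrib_left algebra_simps)+
  have generators: "f (outer_square (incidence_vector S)) \<le> 0"
      "g (outer_square (incidence_vector S)) \<le> 1 / 2 * (real (card C) - 1)"
    if "stable_set (G \<restriction> C) S" for S
  proof -
    note S = stable_set_induce_subgraph[OF that]
    have "2 * card S + 1 \<le> card C"
      using odd_cycle_stable_card[OF assms(3) S] .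
    then have bound: "2 * real (card S) + 1 \<le> real (card C)"
      by linarith
    have "(\<Sum>i\<in>?D. outer_square (incidence_vector S) $ i $ k)
        = (if k \<in> S then real (card S) - 1 else 0)"
      using sum_outer_square_non_neighbors[OF S] .
    note sums = this sum_outer_square_diagonal[OF S(1)]
    show "f (outer_square (incidence_vector S)) \<le> 0"
      unfolding f_def sums using bound by (simp add: outer_square_incidence_vector_nth)
    show "g (outer_square (incidence_vector S)) \<le> 1 / 2 * (real (card C) - 1)"
      unfolding g_def sums using bound
      by (simp add: outer_square_incidence_vector_nth field_simps)
  qed
  have "f X \<le> 0" and "g X \<le> 1 / 2 * (real (card C) - 1)"
    using linear_le_on_STAB2[OF linear(1) assms(5)] linear_le_on_STAB2[OF linear(2) assms(5)]
      generators by blast+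
  then show ?thesis
    unfolding f_def g_def by linarith
qed

end
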